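(* Let $(M_n,g)$, $n>2$, be an $n$-dimensional Riemannian manifold with a unit vector field $\xi$ that is parallel with respect to the Levi-Civita connection $\nabla$, and let $\tilde\nabla$ be the projective semi-symmetric connection determined by $\pi=g(\cdot,\xi)$. Then the Weyl projective curvature tensors of $\tilde\nabla$ and of $\nabla$ coincide: $\tilde P=P$.
   Context: $(M_n,g)$ is an $n$-dimensional Riemannian manifold with Levi-Civita connection $\nabla$; $\xi$ is a vector field with $g(\xi,\xi)=1$ and $\pi(X)=g(X,\xi)$. The projective semi-symmetric connection $\tilde\nabla$ is the linear connection $$\tilde\nabla_XY=\nabla_XY+\psi(Y)X+\psi(X)Y+\phi(Y)X-\phi(X)Y,\qquad \phi=\tfrac12\pi,\quad \psi=\tfrac{n-1}{2(n+1)}\pi ;$$ its torsion is $\tilde T(X,Y)=\pi(Y)X-\pi(X)Y$. $R$ and $\tilde R$ are the curvature tensors of $\nabla$ and $\tilde\nabla$, with $R(X,Y)Z=\nabla_X\nabla_YZ-\nabla_Y\nabla_XZ-\nabla_{[X,Y]}Z$ and likewise for $\tilde R$. The Ricci tensors are $S(Y,Z)=\mathrm{tr}(X\mapsto R(X,Y)Z)$ and $\tilde S(Y,Z)=\mathrm{tr}(X\mapsto\tilde R(X,Y)Z)$. The Weyl projective curvature tensors are $P(X,Y)Z=R(X,Y)Z-\frac{1}{n-1}\{S(Y,Z)X-S(X,Z)Y\}$ and $\tilde P(X,Y)Z=\tilde R(X,Y)Z-\frac{1}{n-1}\{\tilde S(Y,Z)X-\tilde S(X,Z)Y\}$. *)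

theory Defs
  imports "HOL-Analysis.Analysis"
begin

text \<open>On an open set, the following is the usual class of \<open>k\<close> times continuously differentiable maps.\<close>

primrec Ck_on :: "nat \<Rightarrow> 'v::euclidean_space set \<Rightarrow> ('v \<Rightarrow> 'w::real_normed_vector) \<Rightarrow> bool" where
  "Ck_on 0 S f \<longleftrightarrow> continuous_on S f"
| "Ck_on (Suc k) S f \<longleftrightarrow>
     f differentiable_on S \<and> (\<forall>v. Ck_on k S (\<lambda>x. frechet_derivative f (at x) v))"

definition smooth_on :: "'v::euclidean_space set \<Rightarrow> ('v \<Rightarrow> 'w::real_normed_vector) \<Rightarrow> bool" where
  "smooth_on S f \<longleftrightarrow> (\<forall>k. Ck_on k S f)"

text \<open>The points of the manifold are the elements of the Hausdorff, second countable type \<open>'a\<close>;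
  its dimension is \<open>CARD('n)\<close>. A chart is a pair of its domain and its coordinate map.\<close>

type_synonym ('a, 'n) chart = "'a set \<times> ('a \<Rightarrow> real ^ 'n)"

definition chart_inv :: "('a, 'n::finite) chart \<Rightarrow> real ^ 'n \<Rightarrow> 'a" where
  "chart_inv c = inv_into (fst c) (snd c)"

definition chart_image :: "('a, 'n::finite) chart \<Rightarrow> (real ^ 'n) set" where
  "chart_image c = snd c ` fst c"

definition is_chart :: "('a::topological_space, 'n::finite) chart \<Rightarrow> bool" where
  "is_chart c \<longleftrightarrow> open (fst c) \<and> open (chart_image c) \<and>
     homeomorphism (fst c) (chart_image c) (snd c) (chart_inv c)"

definition smooth_manifold ::
    "('a::{t2_space, second_countable_topology}, 'n::finite) chart set \<Rightarrow> bool" where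
  "smooth_manifold A \<longleftrightarrow>
     (\<forall>c\<in>A. is_chart c) \<and> (\<Union>c\<in>A. fst c) = UNIV \<and>
     (\<forall>c\<in>A. \<forall>d\<in>A. smooth_on (snd c ` (fst c \<inter> fst d)) (snd d \<circ> chart_inv c))"

text \<open>Every point \<open>p\<close> gets a preferred chart of the atlas around it, and the tangent space at \<open>p\<close> is
  identified with \<open>real ^ 'n\<close> by means of the coordinate basis of that chart. A vector field is thus a
  function \<open>X :: 'a \<Rightarrow> real ^ 'n\<close>, where \<open>X p\<close> consists of the components of the tangent vector at \<open>p\<close>
  in the preferred chart at \<open>p\<close>. The map \<open>tangent_coord\<close>, the differential of the transition map,
  turns these into the components in any other chart, and smoothness of fields is expressed in
  terms of the latter, so that the choice of preferred charts is immaterial.\<close>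

definition chart_at :: "('a, 'n::finite) chart set \<Rightarrow> 'a \<Rightarrow> ('a, 'n) chart" where
  "chart_at A p = (SOME c. c \<in> A \<and> p \<in> fst c)"

definition tangent_coord ::
    "('a, 'n::finite) chart set \<Rightarrow> ('a, 'n) chart \<Rightarrow> 'a \<Rightarrow> real ^ 'n \<Rightarrow> real ^ 'n" where
  "tangent_coord A c p v =
     frechet_derivative (snd c \<circ> chart_inv (chart_at A p)) (at (snd (chart_at A p) p)) v"

definition smooth_fun :: "('a, 'n::finite) chart set \<Rightarrow> ('a \<Rightarrow> real) \<Rightarrow> bool" where
  "smooth_fun A f \<longleftrightarrow> (\<forall>c\<in>A. smooth_on (chart_image c) (f \<circ> chart_inv c))"

definition field_in_chart ::
    "('a, 'n::finite) chart set \<Rightarrow> ('a, 'n) chart \<Rightarrow> ('a \<Rightarrow> real ^ 'n) \<Rightarrow> real ^ 'n \<Rightarrow> real ^ 'n" where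
  "field_in_chart A c X x = tangent_coord A c (chart_inv c x) (X (chart_inv c x))"

definition smooth_field :: "('a, 'n::finite) chart set \<Rightarrow> ('a \<Rightarrow> real ^ 'n) \<Rightarrow> bool" where
  "smooth_field A X \<longleftrightarrow> (\<forall>c\<in>A. smooth_on (chart_image c) (field_in_chart A c X))"

definition field_apply ::
    "('a, 'n::finite) chart set \<Rightarrow> ('a \<Rightarrow> real ^ 'n) \<Rightarrow> ('a \<Rightarrow> real) \<Rightarrow> 'a \<Rightarrow> real" where
  "field_apply A X f p =
     frechet_derivative (f \<circ> chart_inv (chart_at A p)) (at (snd (chart_at A p) p)) (X p)"

definition lie_bracket ::
    "('a, 'n::finite) chart set \<Rightarrow> ('a \<Rightarrow> real ^ 'n) \<Rightarrow> ('a \<Rightarrow> real ^ 'n) \<Rightarrow> 'a \<Rightarrow> real ^ 'n" where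
  "lie_bracket A X Y p =
     frechet_derivative (field_in_chart A (chart_at A p) Y) (at (snd (chart_at A p) p)) (X p)
   - frechet_derivative (field_in_chart A (chart_at A p) X) (at (snd (chart_at A p) p)) (Y p)"

definition riemannian_metric ::
    "('a, 'n::finite) chart set \<Rightarrow> ('a \<Rightarrow> real ^ 'n \<Rightarrow> real ^ 'n \<Rightarrow> real) \<Rightarrow> bool" where
  "riemannian_metric A g \<longleftrightarrow>
     (\<forall>p. bilinear (g p) \<and> (\<forall>u v. g p u v = g p v u) \<and> (\<forall>v. v \<noteq> 0 \<longrightarrow> 0 < g p v v)) \<and>
     (\<forall>X Y. smooth_field A X \<longrightarrow> smooth_field A Y \<longrightarrow> smooth_fun A (\<lambda>p. g p (X p) (Y p)))"

text \<open>Operators on vector fields are total functions in HOL; they are only constrained on smooth fields.\<close>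

type_synonym ('a, 'n) field_op =
  "('a \<Rightarrow> real ^ 'n) \<Rightarrow> ('a \<Rightarrow> real ^ 'n) \<Rightarrow> 'a \<Rightarrow> real ^ 'n"

definition linear_connection ::
    "('a, 'n::finite) chart set \<Rightarrow> ('a, 'n) field_op \<Rightarrow> bool" where
  "linear_connection A nab \<longleftrightarrow>
     (\<forall>X Y. smooth_field A X \<longrightarrow> smooth_field A Y \<longrightarrow> smooth_field A (nab X Y)) \<and>
     (\<forall>X X' Y. smooth_field A X \<longrightarrow> smooth_field A X' \<longrightarrow> smooth_field A Y \<longrightarrow>
        nab (\<lambda>p. X p + X' p) Y = (\<lambda>p. nab X Y p + nab X' Y p)) \<and>
     (\<forall>f X Y. smooth_fun A f \<longrightarrow> smooth_field A X \<longrightarrow> smooth_field A Y \<longrightarrow>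
        nab (\<lambda>p. f p *\<^sub>R X p) Y = (\<lambda>p. f p *\<^sub>R nab X Y p)) \<and>
     (\<forall>X Y Y'. smooth_field A X \<longrightarrow> smooth_field A Y \<longrightarrow> smooth_field A Y' \<longrightarrow>
        nab X (\<lambda>p. Y p + Y' p) = (\<lambda>p. nab X Y p + nab X Y' p)) \<and>
     (\<forall>f X Y. smooth_fun A f \<longrightarrow> smooth_field A X \<longrightarrow> smooth_field A Y \<longrightarrow>
        nab X (\<lambda>p. f p *\<^sub>R Y p) = (\<lambda>p. f p *\<^sub>R nab X Y p + field_apply A X f p *\<^sub>R Y p))"

definition torsion :: "('a, 'n::finite) chart set \<Rightarrow> ('a, 'n) field_op \<Rightarrow> ('a, 'n) field_op" where
  "torsion A nab X Y p = nab X Y p - nab Y X p - lie_bracket A X Y p"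

definition levi_civita ::
    "('a, 'n::finite) chart set \<Rightarrow> ('a \<Rightarrow> real ^ 'n \<Rightarrow> real ^ 'n \<Rightarrow> real) \<Rightarrow>
     ('a, 'n) field_op \<Rightarrow> bool" where
  "levi_civita A g nab \<longleftrightarrow> linear_connection A nab \<and>
     (\<forall>X Y p. smooth_field A X \<longrightarrow> smooth_field A Y \<longrightarrow> torsion A nab X Y p = 0) \<and>
     (\<forall>X Y Z p. smooth_field A X \<longrightarrow> smooth_field A Y \<longrightarrow> smooth_field A Z \<longrightarrow>
        field_apply A X (\<lambda>q. g q (Y q) (Z q)) p = g p (nab X Y p) (Z p) + g p (Y p) (nab X Z p))"

definition parallel_field ::
    "('a, 'n::finite) chart set \<Rightarrow> ('a, 'n) field_op \<Rightarrow> ('a \<Rightarrow> real ^ 'n) \<Rightarrow> bool" where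
  "parallel_field A nab \<xi> \<longleftrightarrow> (\<forall>X p. smooth_field A X \<longrightarrow> nab X \<xi> p = 0)"

definition curvature ::
    "('a, 'n::finite) chart set \<Rightarrow> ('a, 'n) field_op \<Rightarrow> ('a \<Rightarrow> real ^ 'n) \<Rightarrow> ('a, 'n) field_op" where
  "curvature A nab X Y Z p =
     nab X (nab Y Z) p - nab Y (nab X Z) p - nab (lie_bracket A X Y) Z p"

text \<open>The trace defining the Ricci tensor is that of an endomorphism of the tangent space at \<open>p\<close>. Its
  value at a tangent vector \<open>v\<close> is obtained by extending \<open>v\<close> to a smooth field; as the curvature is
  tensorial, the choice of the extension does not matter.\<close>

definition tangent_extension ::
    "('a, 'n::finite) chart set \<Rightarrow> 'a \<Rightarrow> real ^ 'n \<Rightarrow> 'a \<Rightarrow> real ^ 'n" where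
  "tangent_extension A p v = (SOME X. smooth_field A X \<and> X p = v)"

definition ricci ::
    "('a, 'n::finite) chart set \<Rightarrow> ('a, 'n) field_op \<Rightarrow>
     ('a \<Rightarrow> real ^ 'n) \<Rightarrow> ('a \<Rightarrow> real ^ 'n) \<Rightarrow> 'a \<Rightarrow> real" where
  "ricci A nab Y Z p = trace (matrix (\<lambda>v. curvature A nab (tangent_extension A p v) Y Z p))"

definition weyl_projective ::
    "('a, 'n::finite) chart set \<Rightarrow> ('a, 'n) field_op \<Rightarrow> ('a \<Rightarrow> real ^ 'n) \<Rightarrow> ('a, 'n) field_op" where
  "weyl_projective A nab X Y Z p = curvature A nab X Y Z p
     - (1 / (real CARD('n) - 1)) *\<^sub>R (ricci A nab Y Z p *\<^sub>R X p - ricci A nab X Z p *\<^sub>R Y p)"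

definition assoc_form ::
    "('a \<Rightarrow> real ^ 'n \<Rightarrow> real ^ 'n \<Rightarrow> real) \<Rightarrow> ('a \<Rightarrow> real ^ 'n::finite) \<Rightarrow>
     ('a \<Rightarrow> real ^ 'n) \<Rightarrow> 'a \<Rightarrow> real" where
  "assoc_form g \<xi> X p = g p (X p) (\<xi> p)"

definition phi_form ::
    "('a \<Rightarrow> real ^ 'n \<Rightarrow> real ^ 'n \<Rightarrow> real) \<Rightarrow> ('a \<Rightarrow> real ^ 'n::finite) \<Rightarrow>
     ('a \<Rightarrow> real ^ 'n) \<Rightarrow> 'a \<Rightarrow> real" where
  "phi_form g \<xi> X p = 1 / 2 * assoc_form g \<xi> X p"

definition psi_form ::
    "('a \<Rightarrow> real ^ 'n \<Rightarrow> real ^ 'n \<Rightarrow> real) \<Rightarrow> ('a \<Rightarrow> real ^ 'n::finite) \<Rightarrow>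
     ('a \<Rightarrow> real ^ 'n) \<Rightarrow> 'a \<Rightarrow> real" where
  "psi_form g \<xi> X p = (real CARD('n) - 1) / (2 * (real CARD('n) + 1)) * assoc_form g \<xi> X p"

definition projective_semisymmetric ::
    "('a \<Rightarrow> real ^ 'n \<Rightarrow> real ^ 'n \<Rightarrow> real) \<Rightarrow> ('a \<Rightarrow> real ^ 'n::finite) \<Rightarrow>
     ('a, 'n) field_op \<Rightarrow> ('a, 'n) field_op" where
  "projective_semisymmetric g \<xi> nab X Y p =
     nab X Y p + psi_form g \<xi> Y p *\<^sub>R X p + psi_form g \<xi> X p *\<^sub>R Y p
     + phi_form g \<xi> Y p *\<^sub>R X p - phi_form g \<xi> X p *\<^sub>R Y p"

end

theory Submission
  imports Defs "HOL-Real_Asymp.Real_Asymp"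
begin

text \<open>Combining the terms, the connection is \<open>\<nabla>\<^sub>X Y + a \<pi>(Y) X + b \<pi>(X) Y\<close> with \<open>a = n / (n + 1)\<close> and
  \<open>b = - 1 / (n + 1)\<close>. As \<open>\<xi>\<close> is parallel, \<open>X (\<pi> Y) = \<pi> (\<nabla>\<^sub>X Y)\<close>, and with the vanishing torsion of
  \<open>\<nabla>\<close> everything cancels in the curvature except for \<open>a\<^sup>2 \<pi>(Z) (\<pi>(Y) X - \<pi>(X) Y)\<close>. This changes the
  Ricci tensor by \<open>(n - 1) a\<^sup>2 \<pi>(Y) \<pi>(Z)\<close>, which is exactly what the Weyl tensor compensates for. The
  trace in the Ricci tensor is taken over smooth extensions of tangent vectors, whose existence
  rests on smooth bump functions.\<close>

section \<open>Calculus of smooth maps\<close>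

lemma Ck_on_SucD:
  assumes "open S" "Ck_on (Suc k) S f" "x \<in> S"
  shows "(f has_derivative frechet_derivative f (at x)) (at x)"
  using assms by (auto simp: differentiable_on_eq_differentiable_at frechet_derivative_works[symmetric])

text \<open>Maps that agree on an open set have the same derivatives there, and the induction passes
  to these. Later maps are known only through formulas valid on an open set, so their smoothness is
  transferred from the formulas.\<close>

lemma Ck_on_cong_imp:
  assumes "open S" "Ck_on k S f" "\<And>x. x \<in> S \<Longrightarrow> f x = f' x"
  shows "Ck_on k S f'"
  using assms(2,3)
proof (induction k arbitrary: f f')
  case 0
  then show ?case using continuous_on_cong[of S S f f'] by simp
next
  case (Suc k)
  have D: "(f' has_derivative frechet_derivative f (at x)) (at x)" if "x \<in> S" for x
    by (rule has_derivative_transform_within_open[OF Ck_on_SucD[OF assms(1) Suc.prems(1) that]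
          assms(1) that Suc.prems(2)])
  then have "frechet_derivative f (at x) v = frechet_derivative f' (at x) v" if "x \<in> S" for x v
    using frechet_derivative_at that by metis
  then have "Ck_on k S (\<lambda>x. frechet_derivative f' (at x) v)" for v
    using Suc.IH[of "\<lambda>x. frechet_derivative f (at x) v"] Suc.prems(1) by simp
  moreover have "f' differentiable_on S"
    using assms(1) D by (auto simp: differentiable_on_eq_differentiable_at differentiable_def)
  ultimately show ?case by simp
qed

text \<open>By uniqueness of the derivative, \<open>D x\<close> is
  \<open>frechet_derivative f (at x)\<close> on \<open>S\<close>. The closure properties below can
  thus be proved from explicit derivative formulas.\<close>

lemma Ck_on_SucI:
  assumes "open S" "\<And>x. x \<in> S \<Longrightarrow> (f has_derivative D x) (at x)" "\<And>v. Ck_on k S (\<lambda>x. D x v)"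
  shows "Ck_on (Suc k) S f"
proof -
  have "D x v = frechet_derivative f (at x) v" if "x \<in> S" for x v
    using frechet_derivative_at[OF assms(2)[OF that]] by simp
  then have "Ck_on k S (\<lambda>x. frechet_derivative f (at x) v)" for v
    by (intro Ck_on_cong_imp[OF assms(1) assms(3)])
  moreover have "f differentiable_on S"
    using assms(1,2) by (auto simp: differentiable_on_eq_differentiable_at differentiable_def)
  ultimately show ?thesis by simp
qed

lemma Ck_on_Suc_imp: "open S \<Longrightarrow> Ck_on (Suc k) S f \<Longrightarrow> Ck_on k S f"
proof (induction k arbitrary: f)
  case 0
  then show ?case by (simp add: differentiable_imp_continuous_on)
next
  case (Suc k)
  then show ?case by simp
qed

text \<open>Differentiability of every order is local on open sets; this glues the two pieces of a
  cut-off field.\<close>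

lemma Ck_on_Un: "open S \<Longrightarrow> open T \<Longrightarrow> Ck_on k S f \<Longrightarrow> Ck_on k T f \<Longrightarrow> Ck_on k (S \<union> T) f"
proof (induction k arbitrary: f)
  case 0
  then show ?case by (auto intro: continuous_on_open_Un)
next
  case (Suc k)
  then show ?case by (auto simp: differentiable_on_eq_differentiable_at open_Un)
qed

lemma Ck_on_const: "open S \<Longrightarrow> Ck_on k S (\<lambda>x. c)"
proof (induction k arbitrary: c)
  case (Suc k)
  then show ?case by (intro Ck_on_SucI[where D="\<lambda>x v. 0"]) auto
qed simp

lemma Ck_on_add: "open S \<Longrightarrow> Ck_on k S f \<Longrightarrow> Ck_on k S h \<Longrightarrow> Ck_on k S (\<lambda>x. f x + h x)"
proof (induction k arbitrary: f h)
  case 0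
  then show ?case by (auto intro: continuous_on_add)
next
  case (Suc k)
  show ?case
    using Suc.prems
    by (intro Ck_on_SucI[OF Suc.prems(1) has_derivative_add[OF Ck_on_SucD Ck_on_SucD]] Suc.IH) auto
qed

lemma Ck_on_sum:
  "open S \<Longrightarrow> (\<And>i. i \<in> I \<Longrightarrow> Ck_on k S (f i)) \<Longrightarrow> Ck_on k S (\<lambda>x. \<Sum>i\<in>I. f i x)"
  by (induction I rule: infinite_finite_induct) (auto intro: Ck_on_const Ck_on_add)

lemma Ck_on_scaleR:
  "open S \<Longrightarrow> Ck_on k S f \<Longrightarrow> Ck_on k S h \<Longrightarrow> Ck_on k S (\<lambda>x. f x *\<^sub>R h x)"
proof (induction k arbitrary: f h)
  case 0
  then show ?case by (auto intro: continuous_on_scaleR)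
next
  case (Suc k)
  \<comment> \<open>The product rule contains \<open>f\<close> and \<open>h\<close>
    undifferentiated, so the induction hypothesis also needs them at the lower order
    \<open>k\<close>.\<close>
  have "Ck_on k S f" "Ck_on k S h"
    using Suc.prems Ck_on_Suc_imp by blast+
  then show ?case
    using Suc.prems
    by (intro Ck_on_SucI[OF Suc.prems(1) has_derivative_scaleR[OF Ck_on_SucD Ck_on_SucD]]
        Ck_on_add Suc.IH) auto
qed

lemma Ck_on_bounded_linear:
  assumes "bounded_linear L"
  shows "open S \<Longrightarrow> Ck_on k S f \<Longrightarrow> Ck_on k S (\<lambda>x. L (f x))"
proof (induction k arbitrary: f)
  case 0
  then show ?case using bounded_linear.continuous_on[OF assms] by auto
next
  case (Suc k)
  show ?case
    using Suc.prems
    by (intro Ck_on_SucI[OF Suc.prems(1) bounded_linear.has_derivative[OF assms Ck_on_SucD]] Suc.IH) auto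
qed

lemma Ck_on_ident: "open S \<Longrightarrow> Ck_on k S (\<lambda>x. x)"
proof (cases k)
  case (Suc l)
  assume "open S"
  then show ?thesis
    unfolding Suc by (intro Ck_on_SucI[where D="\<lambda>x v. v"] Ck_on_const has_derivative_ident)
qed simp

lemma Ck_on_compose:
  fixes h :: "'v::euclidean_space \<Rightarrow> 'u::euclidean_space"
  assumes "open S" "open T"
  shows "h ` S \<subseteq> T \<Longrightarrow> Ck_on k S h \<Longrightarrow> Ck_on k T f \<Longrightarrow> Ck_on k S (\<lambda>x. f (h x))"
proof (induction k arbitrary: f)
  case 0
  then show ?case by (auto intro: continuous_on_compose2)
next
  case (Suc k)
  \<comment> \<open>The chain rule evaluates the derivative of \<open>f\<close> in a direction that
    varies with \<open>x\<close>, whereas \<open>Ck_on\<close> controls it only in fixed directions.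
    Expanding the direction in the basis leaves fixed directions \<open>b\<close> with scalar
    coefficients of class \<open>k\<close>.\<close>
  let ?D = "\<lambda>x v. \<Sum>b\<in>Basis. (frechet_derivative h (at x) v \<bullet> b) *\<^sub>R frechet_derivative f (at (h x)) b"
  show ?case
  proof (rule Ck_on_SucI[where D="?D"])
    fix x assume "x \<in> S"
    then have df: "(f has_derivative frechet_derivative f (at (h x))) (at (h x))"
      using Suc.prems by (intro Ck_on_SucD[OF assms(2)]) auto
    interpret linear "frechet_derivative f (at (h x))"
      by (rule has_derivative_linear[OF df])
    have "(\<lambda>v. frechet_derivative f (at (h x)) (frechet_derivative h (at x) v)) = ?D x"
    proof
      fix v
      let ?w = "frechet_derivative h (at x) v"
      have "frechet_derivative f (at (h x)) ?w
          = frechet_derivative f (at (h x)) (\<Sum>b\<in>Basis. (?w \<bullet> b) *\<^sub>R b)"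
        by (simp only: euclidean_representation)
      also have "\<dots> = ?D x v" by (simp add: sum scaleR)
      finally show "frechet_derivative f (at (h x)) ?w = ?D x v" .
    qed
    with has_derivative_compose[OF Ck_on_SucD[OF assms(1) Suc.prems(2) \<open>x \<in> S\<close>] df]
    show "((\<lambda>x. f (h x)) has_derivative ?D x) (at x)" by simp
  next
    fix v
    have "Ck_on k S (\<lambda>x. frechet_derivative f (at (h x)) b)" for b
      using Suc.prems by (intro Suc.IH Ck_on_Suc_imp[OF assms(1) Suc.prems(2)]) auto
    then show "Ck_on k S (\<lambda>x. ?D x v)"
      using Suc.prems(2) assms(1)
      by (intro Ck_on_sum Ck_on_scaleR Ck_on_bounded_linear[OF bounded_linear_inner_left]) auto
  qed (rule assms(1))+
qed

lemma smooth_on_cong_imp: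
  assumes "open S" "smooth_on S f" "\<And>x. x \<in> S \<Longrightarrow> f x = f' x"
  shows "smooth_on S f'"
  unfolding smooth_on_def
proof
  show "Ck_on k S f'" for k
    using Ck_on_cong_imp[OF assms(1) _ assms(3)] assms(2) by (simp add: smooth_on_def)
qed

lemma smooth_on_has_derivative:
  assumes "open S" "smooth_on S f" "x \<in> S"
  shows "(f has_derivative frechet_derivative f (at x)) (at x)"
  using assms by (intro Ck_on_SucD[of S 0]) (auto simp: smooth_on_def simp del: Ck_on.simps)

lemma smooth_on_frechet_derivative:
  "smooth_on S f \<Longrightarrow> smooth_on S (\<lambda>x. frechet_derivative f (at x) v)"
  unfolding smooth_on_def by (metis Ck_on.simps(2))

section \<open>A smooth bump function\<close>

text \<open>For \<open>m = 0\<close> this is the classical smooth function that is flat at 0. The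
  powers in the denominator make the linear span of the family closed under differentiation.\<close>

definition flat_fun :: "nat \<Rightarrow> real \<Rightarrow> real" where
  "flat_fun m t = (if t > 0 then exp (- (1 / t)) / t ^ m else 0)"

lemma flat_fun_has_derivative:
  "(flat_fun m has_real_derivative flat_fun (m + 2) t - real m * flat_fun (m + 1) t) (at t)"
proof -
  consider "t > 0" | "t < 0" | "t = 0" by linarith
  then show ?thesis
  proof cases
    case 1
    have "((\<lambda>t. exp (- (1 / t)) / t ^ m) has_real_derivative
        flat_fun (m + 2) t - real m * flat_fun (m + 1) t) (at t)"
      using 1
      by (auto intro!: derivative_eq_intros simp: flat_fun_def field_simps power2_eq_square)
        (cases m; simp add: field_simps)
    then show ?thesis
      by (rule has_field_derivative_transform_within_open[OF _ open_greaterThan[of 0]]) (use 1 in \<open>auto simp: flat_fun_def\<close>)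
  next
    case 2
    have "((\<lambda>t. 0) has_real_derivative flat_fun (m + 2) t - real m * flat_fun (m + 1) t) (at t)"
      using 2 by (simp add: flat_fun_def)
    then show ?thesis
      by (rule has_field_derivative_transform_within_open[OF _ open_lessThan[of 0]]) (use 2 in \<open>auto simp: flat_fun_def\<close>)
  next
    case 3
    \<comment> \<open>This is the difference quotient at 0 from the right: the exponential decay
      beats every power of \<open>t\<close>. From the left the quotient is identically 0.\<close>
    have "((\<lambda>t::real. exp (- (1 / t)) / t ^ (m + 1)) \<longlongrightarrow> 0) (at_right 0)"
      by real_asymp
    then have "((\<lambda>t. flat_fun m t / t) \<longlongrightarrow> 0) (at_right 0)"
      by (rule Lim_transform_eventually)
        (auto simp: flat_fun_def eventually_at_filter)
    moreover have "((\<lambda>t. flat_fun m t / t) \<longlongrightarrow> 0) (at_left 0)"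
      by (rule Lim_transform_eventually[OF tendsto_const])
        (auto simp: flat_fun_def eventually_at_filter)
    ultimately have "((\<lambda>t. flat_fun m t / t) \<longlongrightarrow> 0) (at 0)"
      by (simp add: filterlim_split_at)
    then show ?thesis
      using 3 by (simp add: has_field_derivative_iff flat_fun_def)
  qed
qed

text \<open>The exponent is kept arbitrary in the induction, because differentiation raises it by 1
  and 2.\<close>

lemma Ck_on_flat_fun: "Ck_on k UNIV (flat_fun m)"
proof (induction k arbitrary: m)
  case 0
  then show ?case
    using flat_fun_has_derivative by (auto intro!: DERIV_continuous_on)
next
  case (Suc k)
  show ?case
  proof (rule Ck_on_SucI[where D="\<lambda>x v. v *\<^sub>R (flat_fun (m + 2) x + (- real m) *\<^sub>R flat_fun (m + 1) x)"])
    show "(flat_fun m has_derivative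
        (\<lambda>v. v *\<^sub>R (flat_fun (m + 2) x + (- real m) *\<^sub>R flat_fun (m + 1) x))) (at x)" for x
      using flat_fun_has_derivative[of m x]
      by (simp add: has_field_derivative_def mult_commute_abs)
  qed (intro Ck_on_scaleR Ck_on_add Ck_on_const Suc.IH open_UNIV)+
qed

lemma smooth_bump_exists:
  fixes a :: "'v::euclidean_space"
  assumes "r > 0"
  obtains \<beta> :: "'v \<Rightarrow> real" where "smooth_on UNIV \<beta>" "\<beta> a = 1" "\<And>x. x \<notin> cball a r \<Longrightarrow> \<beta> x = 0"
proof
  \<comment> \<open>This is the squared radius minus the squared distance to \<open>a\<close>,
    written in coordinates with sums and scalings only, so that the closure rules apply. It is
    negative outside the ball, where \<open>flat_fun 0\<close> vanishes, and equals
    \<open>r^2\<close> at \<open>a\<close>, which fixes the normalising factor.\<close>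
  let ?q = "\<lambda>x::'v. r^2 + (-1) *\<^sub>R (\<Sum>b\<in>Basis. ((x + (- a)) \<bullet> b) *\<^sub>R ((x + (- a)) \<bullet> b))"
  let ?\<beta> = "\<lambda>x. (1 / flat_fun 0 (r^2)) *\<^sub>R flat_fun 0 (?q x)"
  have q: "?q x = r^2 - (dist x a)^2" for x
    by (simp add: dist_norm power2_norm_eq_inner euclidean_inner[of "x - a" "x - a"])
  have "Ck_on k UNIV ?q" for k
    by (intro Ck_on_add Ck_on_scaleR Ck_on_const Ck_on_sum Ck_on_ident open_UNIV
        Ck_on_bounded_linear[OF bounded_linear_inner_left])
  from Ck_on_compose[OF open_UNIV open_UNIV subset_UNIV this Ck_on_flat_fun]
  show "smooth_on UNIV ?\<beta>"
    unfolding smooth_on_def by (intro allI Ck_on_scaleR Ck_on_const open_UNIV)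
  show "?\<beta> a = 1" using assms by (simp add: flat_fun_def)
  show "?\<beta> x = 0" if "x \<notin> cball a r" for x
  proof -
    have "r^2 < (dist x a)^2"
      using that assms by (intro power_strict_mono) (auto simp: dist_commute)
    then show ?thesis unfolding q by (simp add: flat_fun_def)
  qed
qed

section \<open>Charts and smooth fields\<close>

lemma chart_inv_coord:
  assumes "is_chart c" "p \<in> fst c"
  shows "chart_inv c (snd c p) = p"
  using assms by (auto simp: is_chart_def homeomorphism_def)

lemma chart_inv_in:
  assumes "is_chart c" "x \<in> chart_image c"
  shows "chart_inv c x \<in> fst c" "snd c (chart_inv c x) = x"
  using assms by (auto simp: is_chart_def homeomorphism_def)

lemma open_chart_coord_image:
  assumes "is_chart c" "open U"
  shows "open (snd c ` (fst c \<inter> U))"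
proof -
  have "openin (top_of_set (chart_image c)) (snd c ` (fst c \<inter> U))"
    using assms by (auto simp: is_chart_def intro: homeomorphism_imp_open_map openin_open_Int)
  then show ?thesis
    using assms by (auto simp: is_chart_def intro: openin_open_trans)
qed

lemma chart_coord_image_iff:
  assumes "is_chart c"
  shows "x \<in> snd c ` (fst c \<inter> U) \<longleftrightarrow> x \<in> chart_image c \<and> chart_inv c x \<in> U"
proof
  assume "x \<in> snd c ` (fst c \<inter> U)"
  then show "x \<in> chart_image c \<and> chart_inv c x \<in> U"
    using chart_inv_coord[OF assms] by (auto simp: chart_image_def)
next
  assume "x \<in> chart_image c \<and> chart_inv c x \<in> U"
  then have "snd c (chart_inv c x) \<in> snd c ` (fst c \<inter> U)"
    using chart_inv_in[OF assms] by blast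
  then show "x \<in> snd c ` (fst c \<inter> U)"
    using chart_inv_in[OF assms] \<open>x \<in> chart_image c \<and> _\<close> by simp
qed

context
  fixes A :: "('a::{t2_space, second_countable_topology}, 'n::finite) chart set"
  assumes manifold: "smooth_manifold A"
begin

section \<open>Atlas charts, transition maps and their differentials\<close>

lemma is_chart_atlas: "c \<in> A \<Longrightarrow> is_chart c"
  using manifold by (simp add: smooth_manifold_def)

lemma open_chart_domain: "c \<in> A \<Longrightarrow> open (fst c)"
  using is_chart_atlas by (simp add: is_chart_def)

lemma open_chart_image: "c \<in> A \<Longrightarrow> open (chart_image c)"
  using is_chart_atlas by (simp add: is_chart_def)

lemma chart_at_atlas: "chart_at A p \<in> A" "p \<in> fst (chart_at A p)"
proof -
  have "\<exists>c. c \<in> A \<and> p \<in> fst c"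
    using manifold unfolding smooth_manifold_def by blast
  then have "chart_at A p \<in> A \<and> p \<in> fst (chart_at A p)"
    unfolding chart_at_def by (rule someI_ex)
  then show "chart_at A p \<in> A" "p \<in> fst (chart_at A p)" by auto
qed

lemma open_overlap: "c \<in> A \<Longrightarrow> d \<in> A \<Longrightarrow> open (snd c ` (fst c \<inter> fst d))"
  by (simp add: is_chart_atlas open_chart_coord_image open_chart_domain)

lemma smooth_transition:
  "c \<in> A \<Longrightarrow> d \<in> A \<Longrightarrow> smooth_on (snd c ` (fst c \<inter> fst d)) (snd d \<circ> chart_inv c)"
  using manifold by (simp add: smooth_manifold_def)

lemma transition_has_derivative:
  assumes "c \<in> A" "d \<in> A" "p \<in> fst c" "p \<in> fst d"
  shows "((snd d \<circ> chart_inv c) has_derivative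
    frechet_derivative (snd d \<circ> chart_inv c) (at (snd c p))) (at (snd c p))"
  using assms by (intro smooth_on_has_derivative[OF open_overlap smooth_transition]) auto

text \<open>The chain rule for the passage from \<open>c\<close> to \<open>d\<close> by way of
  \<open>e\<close>. With \<open>e\<close> the preferred chart at \<open>p\<close>, it removes that
  choice from \<open>tangent_coord\<close>.\<close>

lemma transition_derivative_compose:
  assumes "c \<in> A" "d \<in> A" "e \<in> A" "p \<in> fst c" "p \<in> fst d" "p \<in> fst e"
  shows "frechet_derivative (snd d \<circ> chart_inv e) (at (snd e p))
      (frechet_derivative (snd e \<circ> chart_inv c) (at (snd c p)) v)
    = frechet_derivative (snd d \<circ> chart_inv c) (at (snd c p)) v"
proof -
  let ?De = "frechet_derivative (snd e \<circ> chart_inv c) (at (snd c p))"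
  let ?Dd = "frechet_derivative (snd d \<circ> chart_inv e) (at (snd e p))"
  have p: "(snd e \<circ> chart_inv c) (snd c p) = snd e p"
    using assms by (simp add: chart_inv_coord is_chart_atlas)
  have "((\<lambda>x. (snd d \<circ> chart_inv e) ((snd e \<circ> chart_inv c) x)) has_derivative (\<lambda>v. ?Dd (?De v))) (at (snd c p))"
    using has_derivative_compose[OF transition_has_derivative[OF assms(1,3,4,6)], of "snd d \<circ> chart_inv e" ?Dd]
      transition_has_derivative[OF assms(3,2,6,5)] unfolding p by simp
  \<comment> \<open>The detour through \<open>e\<close> agrees with the direct transition on the
    overlap of \<open>c\<close> and \<open>e\<close>, an open neighbourhood in coordinates, which
    suffices for equal derivatives.\<close>
  then have "((snd d \<circ> chart_inv c) has_derivative (\<lambda>v. ?Dd (?De v))) (at (snd c p))"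
  proof (rule has_derivative_transform_within_open[OF _ open_overlap[OF assms(1,3)]])
    show "snd c p \<in> snd c ` (fst c \<inter> fst e)" using assms by blast
    show "(snd d \<circ> chart_inv e) ((snd e \<circ> chart_inv c) x) = (snd d \<circ> chart_inv c) x"
      if "x \<in> snd c ` (fst c \<inter> fst e)" for x
      using that assms(1,3) by (simp add: chart_coord_image_iff chart_inv_coord is_chart_atlas)
  qed
  from frechet_derivative_at[OF this] show ?thesis by metis
qed

lemma linear_tangent_coord:
  assumes "c \<in> A" "p \<in> fst c"
  shows "linear (tangent_coord A c p)"
proof -
  have "tangent_coord A c p
      = frechet_derivative (snd c \<circ> chart_inv (chart_at A p)) (at (snd (chart_at A p) p))"
    by (rule ext) (rule tangent_coord_def)
  then show ?thesis
    using has_derivative_linear[OF transition_has_derivative[OF chart_at_atlas(1) assms(1) chart_at_atlas(2) assms(2)]]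
    by simp
qed

lemma linear_tangent_coord_chart_inv:
  "c \<in> A \<Longrightarrow> x \<in> chart_image c \<Longrightarrow> linear (tangent_coord A c (chart_inv c x))"
  by (simp add: linear_tangent_coord chart_inv_in is_chart_atlas)

section \<open>Smooth fields and the extension of tangent vectors\<close>

lemma smooth_field_add:
  assumes "smooth_field A X" "smooth_field A Y"
  shows "smooth_field A (\<lambda>p. X p + Y p)"
  unfolding smooth_field_def
proof
  fix c assume c: "c \<in> A"
  have "smooth_on (chart_image c) (\<lambda>x. field_in_chart A c X x + field_in_chart A c Y x)"
    using assms c open_chart_image[OF c] by (auto simp: smooth_field_def smooth_on_def intro: Ck_on_add)
  moreover have "field_in_chart A c X x + field_in_chart A c Y x = field_in_chart A c (\<lambda>p. X p + Y p) x"
    if "x \<in> chart_image c" for x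
    using linear_add[OF linear_tangent_coord_chart_inv[OF c that]] by (simp add: field_in_chart_def)
  ultimately show "smooth_on (chart_image c) (field_in_chart A c (\<lambda>p. X p + Y p))"
    by (rule smooth_on_cong_imp[OF open_chart_image[OF c]])
qed

lemma smooth_field_scaleR:
  assumes "smooth_fun A f" "smooth_field A X"
  shows "smooth_field A (\<lambda>p. f p *\<^sub>R X p)"
  unfolding smooth_field_def
proof
  fix c assume c: "c \<in> A"
  have "smooth_on (chart_image c) (\<lambda>x. (f \<circ> chart_inv c) x *\<^sub>R field_in_chart A c X x)"
    using assms c open_chart_image[OF c]
    unfolding smooth_fun_def smooth_field_def smooth_on_def by (intro allI Ck_on_scaleR) blast+
  moreover have "(f \<circ> chart_inv c) x *\<^sub>R field_in_chart A c X x = field_in_chart A c (\<lambda>p. f p *\<^sub>R X p) x"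
    if "x \<in> chart_image c" for x
    using linear_scale[OF linear_tangent_coord_chart_inv[OF c that]] by (simp add: field_in_chart_def)
  ultimately show "smooth_on (chart_image c) (field_in_chart A c (\<lambda>p. f p *\<^sub>R X p))"
    by (rule smooth_on_cong_imp[OF open_chart_image[OF c]])
qed

lemma smooth_fun_const: "smooth_fun A (\<lambda>p. k)"
  unfolding smooth_fun_def smooth_on_def by (auto simp: comp_def intro: Ck_on_const open_chart_image)

text \<open>The coordinate field of the preferred chart at \<open>p\<close> is cut off by a bump function supported in a
  closed ball. Its support is compact, hence closed because the manifold is Hausdorff, so that the
  field vanishes on an open set covering the complement of the chart.\<close>

lemma smooth_field_extension_exists: "\<exists>X. smooth_field A X \<and> X p = v"
proof -
  define c where "c = chart_at A p"
  have c: "c \<in> A" "p \<in> fst c" unfolding c_def by (rule chart_at_atlas)+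
  note chart = is_chart_atlas
  have "snd c p \<in> chart_image c" using c by (simp add: chart_image_def)
  then obtain r where r: "r > 0" "cball (snd c p) r \<subseteq> chart_image c"
    using open_chart_image[OF c(1)] open_contains_cball by blast
  obtain \<beta> :: "real ^ 'n \<Rightarrow> real" where
    \<beta>: "smooth_on UNIV \<beta>" "\<beta> (snd c p) = 1" "\<And>x. x \<notin> cball (snd c p) r \<Longrightarrow> \<beta> x = 0"
    using smooth_bump_exists[OF r(1)] by metis
  \<comment> \<open>In the chart \<open>c\<close> this is the constant field \<open>v\<close> times
    the bump. Since fields store components in the preferred chart at \<open>q\<close>, the
    differential of the transition from \<open>c\<close> to that chart is applied.\<close>
  define X where "X q = (if q \<in> fst c then \<beta> (snd c q) *\<^sub>R
      frechet_derivative (snd (chart_at A q) \<circ> chart_inv c) (at (snd c q)) v else 0)" for q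
  define K where "K = chart_inv c ` cball (snd c p) r"
  have "continuous_on (chart_image c) (chart_inv c)"
    using chart[OF c(1)] by (simp add: is_chart_def homeomorphism_def)
  then have "compact K"
    unfolding K_def by (rule compact_continuous_image[OF continuous_on_subset[OF _ r(2)] compact_cball])
  then have openK: "open (- K)" using compact_imp_closed by blast
  have "K \<subseteq> fst c" unfolding K_def using r(2) chart_inv_in[OF chart[OF c(1)]] by blast
  have X_outside: "X q = 0" if "q \<notin> K" for q
  proof (cases "q \<in> fst c")
    case True
    then have "snd c q \<notin> cball (snd c p) r"
      using that chart_inv_coord[OF chart[OF c(1)] True] unfolding K_def by (metis imageI)
    then show ?thesis by (simp add: X_def \<beta>(3))
  qed (simp add: X_def)
  have "smooth_on (chart_image d) (field_in_chart A d X)" if d: "d \<in> A" for d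
  proof -
    let ?U = "snd d ` (fst d \<inter> fst c)" and ?V = "snd d ` (fst d \<inter> - K)"
    let ?\<tau> = "snd c \<circ> chart_inv d"
    let ?D = "\<lambda>y. frechet_derivative (snd d \<circ> chart_inv c) (at y) v"
    have UV: "chart_image d = ?U \<union> ?V"
      using \<open>K \<subseteq> fst c\<close> by (auto simp: chart_image_def)
    have opens: "open ?U" "open ?V"
      using d c openK by (auto intro: open_overlap open_chart_coord_image chart)
    have V: "field_in_chart A d X x = 0" if "x \<in> ?V" for x
    proof -
      from that have "x \<in> chart_image d" "chart_inv d x \<notin> K"
        by (auto simp: chart_coord_image_iff[OF chart[OF d]])
      then show ?thesis
        using linear_0[OF linear_tangent_coord_chart_inv[OF d]]
        by (simp add: field_in_chart_def X_outside)
    qed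
    \<comment> \<open>The preferred chart at \<open>q\<close> may vary wildly with \<open>q\<close>.
      It cancels by the chain rule, leaving only the bump and the smooth transition maps between
      \<open>c\<close> and \<open>d\<close>.\<close>
    have U: "field_in_chart A d X x = \<beta> (?\<tau> x) *\<^sub>R ?D (?\<tau> x)" if "x \<in> ?U" for x
    proof -
      define q where "q = chart_inv d x"
      from that have q: "q \<in> fst d" "q \<in> fst c"
        by (auto simp: q_def chart_inv_coord[OF chart[OF d]])
      have "field_in_chart A d X x = \<beta> (snd c q) *\<^sub>R tangent_coord A d q
          (frechet_derivative (snd (chart_at A q) \<circ> chart_inv c) (at (snd c q)) v)"
        unfolding field_in_chart_def q_def[symmetric]
        using linear_scale[OF linear_tangent_coord[OF d q(1)]] q(2) by (simp add: X_def)
      also have "\<dots> = \<beta> (snd c q) *\<^sub>R ?D (snd c q)"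
        unfolding tangent_coord_def
        using transition_derivative_compose[OF c(1) d chart_at_atlas(1) q(2,1) chart_at_atlas(2)] by simp
      finally show ?thesis by (simp add: q_def)
    qed
    have "Ck_on k (?U \<union> ?V) (field_in_chart A d X)" for k
    proof (rule Ck_on_Un[OF opens])
      show "Ck_on k ?V (field_in_chart A d X)"
        by (rule Ck_on_cong_imp[OF opens(2) Ck_on_const[OF opens(2), of k 0]]) (simp only: V)
      have \<tau>: "Ck_on k ?U ?\<tau>"
        using smooth_transition[OF d c(1)] by (simp add: smooth_on_def)
      have D: "Ck_on k (snd c ` (fst c \<inter> fst d)) ?D"
        using smooth_on_frechet_derivative[OF smooth_transition[OF c(1) d]] by (simp only: smooth_on_def)
      have img: "?\<tau> ` ?U \<subseteq> snd c ` (fst c \<inter> fst d)"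
        by (auto simp: chart_inv_coord[OF chart[OF d]])
      have "Ck_on k ?U (\<lambda>x. ?D (?\<tau> x))"
        by (rule Ck_on_compose[OF opens(1) open_overlap[OF c(1) d] img \<tau> D])
      moreover have "Ck_on k ?U (\<lambda>x. \<beta> (?\<tau> x))"
        using \<beta>(1) by (intro Ck_on_compose[OF opens(1) open_UNIV subset_UNIV \<tau>]) (simp add: smooth_on_def)
      ultimately have "Ck_on k ?U (\<lambda>x. \<beta> (?\<tau> x) *\<^sub>R ?D (?\<tau> x))"
        by (intro Ck_on_scaleR opens)
      then show "Ck_on k ?U (field_in_chart A d X)"
        by (rule Ck_on_cong_imp[OF opens(1)]) (use U in auto)
    qed
    then show ?thesis by (simp add: smooth_on_def UV)
  qed
  then have "smooth_field A X" by (simp add: smooth_field_def)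
  moreover have "X p = v"
  proof -
    \<comment> \<open>The preferred chart at \<open>p\<close> is \<open>c\<close> itself, so the
      transition map there is locally the identity, and the bump equals 1.\<close>
    have "((\<lambda>x. x) has_derivative (\<lambda>v. v)) (at (snd c p))" by (rule has_derivative_ident)
    then have "((snd c \<circ> chart_inv c) has_derivative (\<lambda>v. v)) (at (snd c p))"
      by (rule has_derivative_transform_within_open[OF _ open_chart_image[OF c(1)]])
        (use c chart_inv_in[OF chart[OF c(1)]] in \<open>auto simp: chart_image_def\<close>)
    from frechet_derivative_at[OF this]
    have "frechet_derivative (snd c \<circ> chart_inv c) (at (snd c p)) v = v" by metis
    then show ?thesis by (simp add: X_def c(2) \<beta>(2) flip: c_def)
  qed
  ultimately show ?thesis by blast
qed

lemma tangent_extension: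
  "smooth_field A (tangent_extension A p v)" "tangent_extension A p v p = v"
  using someI_ex[OF smooth_field_extension_exists[of p v]]
  unfolding tangent_extension_def by auto

end

section \<open>The projective semi-symmetric connection\<close>

text \<open>The coefficients are \<open>\<psi> + \<phi>\<close> and \<open>\<psi> - \<phi>\<close>
  as multiples of \<open>\<pi>\<close>. Each correction is a function times a constant multiple of a
  field, the shape to which the Leibniz rule is applied below.\<close>

lemma projective_semisymmetric_eq:
  fixes g :: "'a \<Rightarrow> real ^ 'n::finite \<Rightarrow> real ^ 'n \<Rightarrow> real"
  defines "n \<equiv> real CARD('n)"
  shows "projective_semisymmetric g \<xi> nab X Y = (\<lambda>p. nab X Y p
    + assoc_form g \<xi> Y p *\<^sub>R ((n / (n + 1)) *\<^sub>R X p) + assoc_form g \<xi> X p *\<^sub>R ((- 1 / (n + 1)) *\<^sub>R Y p))"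
proof
  fix p
  define u v where "u = assoc_form g \<xi> X p" and "v = assoc_form g \<xi> Y p"
  have "n + 1 \<noteq> 0" unfolding n_def by simp
  then have coeff: "(n - 1) / (2 * (n + 1)) * v + 1 / 2 * v = v * (n / (n + 1))"
    "(n - 1) / (2 * (n + 1)) * u - 1 / 2 * u = u * (- 1 / (n + 1))"
    by (simp_all add: field_simps)
  have "projective_semisymmetric g \<xi> nab X Y p = nab X Y p
      + ((n - 1) / (2 * (n + 1)) * v + 1 / 2 * v) *\<^sub>R X p
      + ((n - 1) / (2 * (n + 1)) * u - 1 / 2 * u) *\<^sub>R Y p"
    unfolding projective_semisymmetric_def psi_form_def phi_form_def n_def u_def v_def
      scaleR_add_left scaleR_diff_left by simp
  then show "projective_semisymmetric g \<xi> nab X Y p = nab X Y p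
    + assoc_form g \<xi> Y p *\<^sub>R ((n / (n + 1)) *\<^sub>R X p) + assoc_form g \<xi> X p *\<^sub>R ((- 1 / (n + 1)) *\<^sub>R Y p)"
    unfolding coeff scaleR_scaleR unfolding u_def v_def .
qed

lemma field_apply_const: "field_apply A X (\<lambda>p. k) p = 0"
  by (simp add: field_apply_def comp_def)

context
  fixes A :: "('a::{t2_space, second_countable_topology}, 'n::finite) chart set"
    and g :: "'a \<Rightarrow> real ^ 'n \<Rightarrow> real ^ 'n \<Rightarrow> real"
    and nab :: "('a, 'n) field_op"
    and \<xi> :: "'a \<Rightarrow> real ^ 'n"
  assumes manifold: "smooth_manifold A"
    and metric: "riemannian_metric A g"
    and levi_civita: "levi_civita A g nab"
    and smooth_xi: "smooth_field A \<xi>"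
    and parallel: "parallel_field A nab \<xi>"
begin

section \<open>Rules for the Levi-Civita connection and the form \<open>\<pi>\<close>\<close>

lemma nab_simps:
  assumes "smooth_field A X" "smooth_field A Y"
  shows smooth_nab: "smooth_field A (nab X Y)"
    and nab_add: "smooth_field A Y' \<Longrightarrow> nab X (\<lambda>p. Y p + Y' p) = (\<lambda>p. nab X Y p + nab X Y' p)"
    and nab_scaleR: "smooth_fun A f \<Longrightarrow>
      nab X (\<lambda>p. f p *\<^sub>R Y p) = (\<lambda>p. f p *\<^sub>R nab X Y p + field_apply A X f p *\<^sub>R Y p)"
    and nab_scaleR_const: "nab X (\<lambda>p. k *\<^sub>R Y p) = (\<lambda>p. k *\<^sub>R nab X Y p)"
    and lie_bracket_eq: "lie_bracket A X Y p = nab X Y p - nab Y X p"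
proof -
  have conn: "linear_connection A nab" and tor: "torsion A nab X Y p = 0"
    using levi_civita assms by (auto simp: levi_civita_def)
  show "smooth_field A (nab X Y)"
    using conn assms by (simp add: linear_connection_def)
  show "nab X (\<lambda>p. Y p + Y' p) = (\<lambda>p. nab X Y p + nab X Y' p)" if "smooth_field A Y'"
    using conn assms that by (simp add: linear_connection_def)
  show *: "nab X (\<lambda>p. f p *\<^sub>R Y p) = (\<lambda>p. f p *\<^sub>R nab X Y p + field_apply A X f p *\<^sub>R Y p)"
    if "smooth_fun A f" for f
    using conn assms that by (simp add: linear_connection_def)
  show "nab X (\<lambda>p. k *\<^sub>R Y p) = (\<lambda>p. k *\<^sub>R nab X Y p)"
    \<comment> \<open>A constant factor is a smooth function with zero derivative, so the Leibniz
      rule reduces to homogeneity.\<close>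
    using *[OF smooth_fun_const[OF manifold]] by (simp add: field_apply_const)
  show "lie_bracket A X Y p = nab X Y p - nab Y X p"
    using tor by (simp add: torsion_def)
qed

lemma bilinear_metric: "bilinear (g p)"
  using metric by (simp add: riemannian_metric_def)

lemma smooth_assoc_form: "smooth_field A X \<Longrightarrow> smooth_fun A (assoc_form g \<xi> X)"
  using metric smooth_xi unfolding riemannian_metric_def assoc_form_def[abs_def] by blast

text \<open>Metric compatibility gives a second term, the product of \<open>Y\<close> with the
  covariant derivative of \<open>\<xi>\<close>. It vanishes because \<open>\<xi>\<close> is
  parallel.\<close>

lemma field_apply_assoc_form:
  assumes "smooth_field A X" "smooth_field A Y"
  shows "field_apply A X (assoc_form g \<xi> Y) p = assoc_form g \<xi> (nab X Y) p"
proof -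
  have "nab X \<xi> p = 0" using parallel assms by (simp add: parallel_field_def)
  then show ?thesis
    using levi_civita assms smooth_xi
    by (simp add: levi_civita_def assoc_form_def[abs_def] bilinear_rzero[OF bilinear_metric])
qed

lemma assoc_form_linear:
  "assoc_form g \<xi> (\<lambda>p. X p + Y p) p = assoc_form g \<xi> X p + assoc_form g \<xi> Y p"
  "assoc_form g \<xi> (\<lambda>p. f p *\<^sub>R X p) p = f p * assoc_form g \<xi> X p"
  by (simp_all add: assoc_form_def bilinear_ladd[OF bilinear_metric] bilinear_lmul[OF bilinear_metric])

lemma assoc_form_lie_bracket:
  assumes "smooth_field A X" "smooth_field A Y"
  shows "assoc_form g \<xi> (lie_bracket A X Y) p = assoc_form g \<xi> (nab X Y) p - assoc_form g \<xi> (nab Y X) p"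
  by (simp add: assoc_form_def lie_bracket_eq[OF assms] bilinear_lsub[OF bilinear_metric])

section \<open>Curvature and Ricci tensor of the projective semi-symmetric connection\<close>

lemma projective_semisymmetric_twice:
  fixes X Y Z p
  defines "n \<equiv> real CARD('n)" and "\<pi> \<equiv> assoc_form g \<xi>"
  defines "a \<equiv> n / (n + 1)" and "b \<equiv> - 1 / (n + 1)"
  assumes "smooth_field A X" "smooth_field A Y" "smooth_field A Z"
  shows "projective_semisymmetric g \<xi> nab X (projective_semisymmetric g \<xi> nab Y Z) p =
    nab X (nab Y Z) p
    + (a * \<pi> Z p) *\<^sub>R nab X Y p + (a * \<pi> (nab X Z) p) *\<^sub>R Y p
    + (b * \<pi> Y p) *\<^sub>R nab X Z p + (b * \<pi> (nab X Y) p) *\<^sub>R Z p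
    + (a * (\<pi> (nab Y Z) p + a * \<pi> Z p * \<pi> Y p + b * \<pi> Y p * \<pi> Z p)) *\<^sub>R X p
    + (b * \<pi> X p) *\<^sub>R (nab Y Z p + (a * \<pi> Z p) *\<^sub>R Y p + (b * \<pi> Y p) *\<^sub>R Z p)"
proof -
  note smooth = assms(5-7)
  let ?aY = "\<lambda>p. a *\<^sub>R Y p" and ?bZ = "\<lambda>p. b *\<^sub>R Z p"
  \<comment> \<open>The inner derivative as a sum of three fields. The laws of \<open>nab\<close>
    hold for smooth fields only, so each summand is first shown smooth.\<close>
  let ?W = "\<lambda>p. nab Y Z p + \<pi> Z p *\<^sub>R ?aY p + \<pi> Y p *\<^sub>R ?bZ p"
  have W: "projective_semisymmetric g \<xi> nab Y Z = ?W"
    unfolding projective_semisymmetric_eq n_def \<pi>_def a_def b_def ..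
  have aY: "smooth_field A ?aY" and bZ: "smooth_field A ?bZ"
    using smooth by (auto intro: smooth_field_scaleR[OF manifold smooth_fun_const[OF manifold]])
  have \<pi>: "smooth_fun A (\<pi> Y)" "smooth_fun A (\<pi> Z)"
    using smooth by (auto simp: \<pi>_def smooth_assoc_form)
  have s1: "smooth_field A (\<lambda>p. \<pi> Z p *\<^sub>R ?aY p)" and s2: "smooth_field A (\<lambda>p. \<pi> Y p *\<^sub>R ?bZ p)"
    by (rule smooth_field_scaleR[OF manifold \<pi>(2) aY], rule smooth_field_scaleR[OF manifold \<pi>(1) bZ])
  have s0: "smooth_field A (\<lambda>p. nab Y Z p + \<pi> Z p *\<^sub>R ?aY p)"
    by (rule smooth_field_add[OF manifold smooth_nab[OF smooth(2,3)] s1])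
  have "nab X ?W p = nab X (nab Y Z) p + nab X (\<lambda>p. \<pi> Z p *\<^sub>R ?aY p) p + nab X (\<lambda>p. \<pi> Y p *\<^sub>R ?bZ p) p"
    unfolding nab_add[OF smooth(1) s0 s2] nab_add[OF smooth(1) smooth_nab[OF smooth(2,3)] s1] ..
  also have "nab X (\<lambda>p. \<pi> Z p *\<^sub>R ?aY p) p = (a * \<pi> Z p) *\<^sub>R nab X Y p + (a * \<pi> (nab X Z) p) *\<^sub>R Y p"
    unfolding nab_scaleR[OF smooth(1) aY \<pi>(2)] nab_scaleR_const[OF smooth(1,2)]
    unfolding \<pi>_def field_apply_assoc_form[OF smooth(1,3)] by (simp add: mult.commute)
  also have "nab X (\<lambda>p. \<pi> Y p *\<^sub>R ?bZ p) p = (b * \<pi> Y p) *\<^sub>R nab X Z p + (b * \<pi> (nab X Y) p) *\<^sub>R Z p"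
    unfolding nab_scaleR[OF smooth(1) bZ \<pi>(1)] nab_scaleR_const[OF smooth(1,3)]
    unfolding \<pi>_def field_apply_assoc_form[OF smooth(1,2)] by (simp add: mult.commute)
  finally have nabW: "nab X ?W p = nab X (nab Y Z) p
    + ((a * \<pi> Z p) *\<^sub>R nab X Y p + (a * \<pi> (nab X Z) p) *\<^sub>R Y p)
    + ((b * \<pi> Y p) *\<^sub>R nab X Z p + (b * \<pi> (nab X Y) p) *\<^sub>R Z p)" .
  \<comment> \<open>The outer connection also evaluates \<open>\<pi>\<close> on the inner
    derivative, which contributes terms quadratic in \<open>\<pi>\<close>.\<close>
  have piW: "\<pi> ?W p = \<pi> (nab Y Z) p + a * \<pi> Z p * \<pi> Y p + b * \<pi> Y p * \<pi> Z p"
    unfolding \<pi>_def assoc_form_linear by simp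
  have "projective_semisymmetric g \<xi> nab X ?W p = nab X ?W p + \<pi> ?W p *\<^sub>R (a *\<^sub>R X p) + \<pi> X p *\<^sub>R (b *\<^sub>R ?W p)"
    unfolding projective_semisymmetric_eq n_def \<pi>_def a_def b_def ..
  then show ?thesis
    unfolding W nabW piW by (simp add: algebra_simps)
qed

text \<open>Under exchange of \<open>X\<close> and \<open>Y\<close>, the terms with derivatives of
  \<open>Z\<close> beyond those in the old curvature are symmetric and cancel, as does the
  \<open>b\<^sup>2\<close> term. The terms with \<open>nab X Y - nab Y X\<close> cancel against the
  bracket. The coefficient left over is \<open>a * (a + b) - a * b\<close>, that is,
  \<open>a\<^sup>2\<close>.\<close>

lemma curvature_projective_semisymmetric:
  fixes X Y Z p
  defines "n \<equiv> real CARD('n)" and "\<pi> \<equiv> assoc_form g \<xi>"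
  assumes "smooth_field A X" "smooth_field A Y" "smooth_field A Z"
  shows "curvature A (projective_semisymmetric g \<xi> nab) X Y Z p = curvature A nab X Y Z p
    + ((n / (n + 1))\<^sup>2 * \<pi> Z p) *\<^sub>R (\<pi> Y p *\<^sub>R X p - \<pi> X p *\<^sub>R Y p)"
proof -
  define a b where "a = n / (n + 1)" and "b = - 1 / (n + 1)"
  note twice = projective_semisymmetric_twice[folded n_def, folded \<pi>_def, folded a_def b_def]
  have "projective_semisymmetric g \<xi> nab (lie_bracket A X Y) Z p = nab (lie_bracket A X Y) Z p
    + (\<pi> Z p * a) *\<^sub>R (nab X Y p - nab Y X p) + ((\<pi> (nab X Y) p - \<pi> (nab Y X) p) * b) *\<^sub>R Z p"
    unfolding projective_semisymmetric_eq \<pi>_def a_def b_def n_def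
      assoc_form_lie_bracket[OF assms(3,4)] lie_bracket_eq[OF assms(3,4)] scaleR_scaleR ..
  then show ?thesis
    unfolding curvature_def twice[OF assms(3,4,5)] twice[OF assms(4,3,5)] a_def[symmetric]
    by (simp add: algebra_simps power2_eq_square)
qed

lemma ricci_projective_semisymmetric:
  fixes Y Z p
  defines "n \<equiv> real CARD('n)" and "\<pi> \<equiv> assoc_form g \<xi>"
  assumes "smooth_field A Y" "smooth_field A Z"
  shows "ricci A (projective_semisymmetric g \<xi> nab) Y Z p
    = ricci A nab Y Z p + (n / (n + 1))\<^sup>2 * (n - 1) * \<pi> Y p * \<pi> Z p"
proof -
  define k where "k = (n / (n + 1))\<^sup>2 * \<pi> Z p"
  let ?e = "\<lambda>i. axis i 1 :: real ^ 'n"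
  have \<pi>_ext: "\<pi> (tangent_extension A p v) p = g p v (\<xi> p)" for v
    by (simp add: \<pi>_def assoc_form_def tangent_extension[OF manifold])
  \<comment> \<open>The right-hand side is the trace of the rank one map sending \<open>v\<close> to
    \<open>g p v (\<xi> p)\<close> times \<open>Y p\<close>. Expanding \<open>Y p\<close> in the
    coordinate basis shows that it equals \<open>\<pi> Y p\<close>.\<close>
  have "\<pi> Y p = (\<Sum>i\<in>UNIV. Y p $ i * g p (?e i) (\<xi> p))"
  proof -
    have lin: "linear (\<lambda>v. g p v (\<xi> p))" using bilinear_metric by (simp add: bilinear_def)
    have "\<pi> Y p = g p (\<Sum>i\<in>UNIV. Y p $ i *s ?e i) (\<xi> p)"
      by (simp add: \<pi>_def assoc_form_def basis_expansion)
    also have "\<dots> = (\<Sum>i\<in>UNIV. Y p $ i * g p (?e i) (\<xi> p))"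
      by (simp add: scalar_mult_eq_scaleR linear_sum[OF lin] linear_scale[OF lin])
    finally show ?thesis .
  qed
  then have tr: "(\<Sum>i\<in>UNIV. k * (\<pi> Y p - g p (?e i) (\<xi> p) * Y p $ i)) = k * (n * \<pi> Y p - \<pi> Y p)"
    by (simp add: n_def sum_subtractf mult.commute flip: sum_distrib_left)
  \<comment> \<open>The diagonal entries of the matrix. In the curvature correction the extension of
    a basis vector enters only through its value at \<open>p\<close>.\<close>
  have "ricci A (projective_semisymmetric g \<xi> nab) Y Z p
      = (\<Sum>i\<in>UNIV. curvature A nab (tangent_extension A p (?e i)) Y Z p $ i
          + k * (\<pi> Y p - g p (?e i) (\<xi> p) * Y p $ i))"
    unfolding ricci_def trace_def matrix_def
    by (simp add: curvature_projective_semisymmetric[OF tangent_extension(1)[OF manifold] assms(3,4)]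
        tangent_extension(2)[OF manifold] \<pi>_ext k_def flip: n_def \<pi>_def)
  also have "\<dots> = ricci A nab Y Z p + k * (n * \<pi> Y p - \<pi> Y p)"
    unfolding sum.distrib tr by (simp add: ricci_def trace_def matrix_def)
  finally show ?thesis by (simp add: k_def algebra_simps)
qed

end

theorem theorem3p1:
  fixes A :: "('a::{t2_space, second_countable_topology}, 'n::finite) chart set"
    and g :: "'a \<Rightarrow> real ^ 'n \<Rightarrow> real ^ 'n \<Rightarrow> real"
    and nab :: "('a, 'n) field_op"
    and \<xi> :: "'a \<Rightarrow> real ^ 'n"
  assumes "CARD('n) > 2"
    and "smooth_manifold A"
    and "riemannian_metric A g"
    and "levi_civita A g nab"
    and "smooth_field A \<xi>"
    and "\<forall>p. g p (\<xi> p) (\<xi> p) = 1"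
    and "parallel_field A nab \<xi>"
  shows "\<forall>X Y Z. smooth_field A X \<longrightarrow> smooth_field A Y \<longrightarrow> smooth_field A Z \<longrightarrow>
    weyl_projective A (projective_semisymmetric g \<xi> nab) X Y Z = weyl_projective A nab X Y Z"
proof (intro allI impI ext)
  fix X Y Z p
  assume smooth: "smooth_field A X" "smooth_field A Y" "smooth_field A Z"
  let ?n = "real CARD('n)"
  \<comment> \<open>With \<open>k\<close> and \<open>m\<close> as opaque constants, the Ricci
    corrections carry a factor \<open>m\<close> that cancels the \<open>1 / m\<close> of the Weyl
    tensor, as \<open>m\<close> is nonzero. What remains is the curvature correction, with opposite
    sign.\<close>
  define k where "k = (?n / (?n + 1))\<^sup>2"
  define m where "m = ?n - 1"
  have m: "m \<noteq> 0" using assms(1) by (simp add: m_def)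
  note ctx = assms(2-5,7)
  show "weyl_projective A (projective_semisymmetric g \<xi> nab) X Y Z p = weyl_projective A nab X Y Z p"
    unfolding weyl_projective_def curvature_projective_semisymmetric[OF ctx smooth]
      ricci_projective_semisymmetric[OF ctx smooth(2,3)] ricci_projective_semisymmetric[OF ctx smooth(1,3)]
      k_def[symmetric] m_def[symmetric]
    using m by (simp add: algebra_simps)
qed

end
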